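(* Consider the general network interaction model described in the context, with $n=|\mathcal{I}|$. Assume that the treatments $\{D_k\}_{k\in\mathcal{I}\cup\mathcal{J}}$ are mutually independent with $\Pr(D_i=d)=p_d^{\mathcal{I}}$ for $i\in\mathcal{I}$ and $\Pr(D_j=d)=p_d^{\mathcal{J}}$ for $j\in\mathcal{J}$, $d\in\{0,1\}$, and that for each $(d,r)\in\{0,1\}\times\mathcal{R}_i$, $(D_i,\boldsymbol{D}_{\mathcal{P}_i})$ is independent of $(Y_i(d,r),\boldsymbol{A}_{\mathcal{P}_i})$. Assume also that the potential outcomes $\{Y_i(d,r)\}_{(d,r)\in\{0,1\}\times\mathcal{R}_i}$ together with $\boldsymbol{A}_{\mathcal{P}_i}$ are independent across $i\in\mathcal{I}$ (not necessarily identically distributed). Suppose $\beta_s^{2sls}$ is determined (through a unique minimizer) by $$(\beta_0^{2sls}, \beta_d^{2sls}, \beta_s^{2sls}) = \operatorname*{argmin}_{b_0, b_d, b_s\in\mathbb{R}} \sum_{i\in\mathcal{I}} \mathbb{E}\big[(Y_i - b_0 - b_d D_i - b_s \mathbb{L}(M_i \mid D_i, D_{1(i)}))^2\big],$$ where $\mathbb{L}(M_i \mid D_i, D_{1(i)}) := \gamma_0 + \gamma_d D_i + \gamma_s D_{1(i)}$ and $(\gamma_0, \gamma_d, \gamma_s) = \operatorname*{argmin}_{a_0, a_d, a_s\in\mathbb{R}} \sum_{i\in\mathcal{I}} \mathbb{E}[(M_i - a_0 - a_d D_i - a_s D_{1(i)})^2]$. Then $$\beta_s^{2sls} = \frac{1}{n}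 \sum_{i\in\mathcal{I}} \sum_{r = 1}^{n_i} \omega_i(r)\, \mathbb{E}[ \bar\tau_i^1(r) \mid R_i(1) \ge r > R_i(0)],$$ where $$\omega_i(r) := \frac{\Pr( R_i(1) \ge r > R_i(0))}{n^{-1} \sum_{k\in\mathcal{I}} \mathbb{E}[M_k^1 - M_k^0]},\qquad M_i^d := M_i(R_i(d)),\ d\in\{0,1\}.$$
   Context: General network model. There are two disjoint finite samples: the focal sample $\mathcal{I}$ and the peer sample $\mathcal{J}$. Each $i\in\mathcal{I}$ has a fixed (non-random) set of potential peers $\mathcal{P}_i=\{1(i),\ldots,n_i(i)\}\subseteq\mathcal{J}$ with $n_i=|\mathcal{P}_i|\ge 1$, possibly varying with $i$; the sets $\mathcal{P}_i$ and $\mathcal{P}_{i'}$ are disjoint for $i\ne i'$. Each unit $k\in\mathcal{I}\cup\mathcal{J}$ has a random treatment $D_k\in\{0,1\}$; put $\boldsymbol{D}_{\mathcal{P}_i}=(D_{1(i)},\ldots,D_{n_i(i)})^\top$. Link connections are the random vector $\boldsymbol{A}_{\mathcal{P}_i}=(A_{1(i)},\ldots,A_{n_i(i)})^\top$ with values in $\mathcal{A}_i:=\{0,1\}^{n_i}$, where $A_{j(i)}=1$ means the treatment of the $j$-th peer affects $i$'s outcome. The number of treated effective peers is $R_i:=\boldsymbol{A}_{\mathcal{P}_i}^\top\boldsymbol{D}_{\mathcal{P}_i}\in\mathcal{R}_i:=\{0,1,\ldots,n_i\}$. For $(d,r)\in\{0,1\}\times\mathcal{R}_i$, $Y_i(d,r)$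 is a real random variable (potential outcome), and the observed outcome is $Y_i=\sum_{(d,r)\in\{0,1\}\times\mathcal{R}_i}\mathbf{1}\{D_i=d,R_i=r\}Y_i(d,r)$. For each $i$, $M_i:\mathcal{R}_i\to\mathbb{R}$ is a known (deterministic) non-decreasing function; when written without argument, $M_i$ denotes the random variable $M_i(R_i)$. The treatment $D_{1(i)}$ of the first peer is used as the instrument. For $d\in\{0,1\}$ define $R_i(d):=A_{1(i)}d+A_{2(i)}D_{2(i)}+\cdots+A_{n_i(i)}D_{n_i(i)}$, so that $R_i=D_{1(i)}R_i(1)+(1-D_{1(i)})R_i(0)$. Experimental design: the treatments $\{D_k\}_{k\in\mathcal{I}\cup\mathcal{J}}$ are mutually independent with $\Pr(D_i=d)=p_d^{\mathcal{I}}$ for $i\in\mathcal{I}$ and $\Pr(D_j=d)=p_d^{\mathcal{J}}$ for $j\in\mathcal{J}$, $d\in\{0,1\}$. In addition, for each $(d,r)\in\{0,1\}\times\mathcal{R}_i$, $(D_i,\boldsymbol{D}_{\mathcal{P}_i})$ is independent of $(Y_i(d,r),\boldsymbol{A}_{\mathcal{P}_i})$. Independence across units: the potential outcomes $\{Y_i(d,r)\}_{(d,r)\in\{0,1\}\times\mathcal{R}_i}$ together with $\boldsymbol{A}_{\mathcal{P}_i}$ are independent across $i\in\mathcal{I}$ (not necessarily identically distributed). Dependence between $\boldsymbol{A}_{\mathcal{P}_i}$ and the potential outcomes of $i$ is allowed. Potential outcomes have finite second moments. A term consisting of a conditional expectation given a null event multiplied by a zero weight is read as $0$. Effects: for $r\in\{1,\ldots,n_i\}$,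 $\tau_i^1(d,r):=Y_i(d,r)-Y_i(d,r-1)$ and $\bar\tau_i^1(r):=\tau_i^1(1,r)p_1^{\mathcal{I}}+\tau_i^1(0,r)p_0^{\mathcal{I}}$. *)

theory Defs
  imports "HOL-Probability.Probability"
begin

text \<open>
  The sample space has type 'w, the units type 'u.  The potential peers of the focal unit i are
  peer N i 1, ..., peer N i (npeers N i); link N i j is the link indicator of the j-th of them.
  The function aggr N i plays the role of M_i, and p_focal N d, p_peer N d are the treatment
  probabilities in the two samples.  Treatments and links are random variables with values in the
  set {0,1} of natural numbers.  Arguments outside their intended range are unconstrained.
\<close>

record ('u, 'w) network =
  pspace :: "'w measure"
  focal :: "'u set"
  peer_sample :: "'u set"
  npeers :: "'u \<Rightarrow> nat"
  peer :: "'u \<Rightarrow> nat \<Rightarrow> 'u"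
  treat :: "'u \<Rightarrow> 'w \<Rightarrow> nat"
  link :: "'u \<Rightarrow> nat \<Rightarrow> 'w \<Rightarrow> nat"
  outcome :: "'u \<Rightarrow> nat \<Rightarrow> nat \<Rightarrow> 'w \<Rightarrow> real"
  aggr :: "'u \<Rightarrow> nat \<Rightarrow> real"
  p_focal :: "nat \<Rightarrow> real"
  p_peer :: "nat \<Rightarrow> real"

definition potential_peers :: "('u, 'w) network \<Rightarrow> 'u \<Rightarrow> 'u set" where
  "potential_peers N i = peer N i ` {1..npeers N i}"

locale network_model = prob_space "pspace N" for N :: "('u, 'w) network" +
  assumes finite_focal: "finite (focal N)"
    and finite_peer_sample: "finite (peer_sample N)"
    and disjoint_samples: "focal N \<inter> peer_sample N = {}"
    and npeers_ge_1: "\<And>i. i \<in> focal N \<Longrightarrow> 1 \<le> npeers N i"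
    and inj_peer: "\<And>i. i \<in> focal N \<Longrightarrow> inj_on (peer N i) {1..npeers N i}"
    and potential_peers_subset: "\<And>i. i \<in> focal N \<Longrightarrow> potential_peers N i \<subseteq> peer_sample N"
    and disjoint_potential_peers: "disjoint_family_on (potential_peers N) (focal N)"
    and random_treat:
      "\<And>k. k \<in> focal N \<union> peer_sample N \<Longrightarrow> random_variable (count_space {0, 1}) (treat N k)"
    and random_link:
      "\<And>i j. i \<in> focal N \<Longrightarrow> j \<in> {1..npeers N i} \<Longrightarrow>
         random_variable (count_space {0, 1}) (link N i j)"
    and random_outcome:
      "\<And>i d r. i \<in> focal N \<Longrightarrow> d \<in> {0, 1} \<Longrightarrow> r \<in> {0..npeers N i} \<Longrightarrow>
         random_variable borel (outcome N i d r)"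
    and second_moment_outcome:
      "\<And>i d r. i \<in> focal N \<Longrightarrow> d \<in> {0, 1} \<Longrightarrow> r \<in> {0..npeers N i} \<Longrightarrow>
         integrable (pspace N) (\<lambda>\<omega>. (outcome N i d r \<omega>)\<^sup>2)"
    and mono_aggr: "\<And>i. i \<in> focal N \<Longrightarrow> mono_on {0..npeers N i} (aggr N i)"

definition link_vec :: "('u, 'w) network \<Rightarrow> 'u \<Rightarrow> 'w \<Rightarrow> nat \<Rightarrow> nat" where
  "link_vec N i \<omega> = (\<lambda>j\<in>{1..npeers N i}. link N i j \<omega>)"

definition peer_treat_vec :: "('u, 'w) network \<Rightarrow> 'u \<Rightarrow> 'w \<Rightarrow> nat \<Rightarrow> nat" where
  "peer_treat_vec N i \<omega> = (\<lambda>j\<in>{1..npeers N i}. treat N (peer N i j) \<omega>)"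

definition outcome_vec :: "('u, 'w) network \<Rightarrow> 'u \<Rightarrow> 'w \<Rightarrow> nat \<times> nat \<Rightarrow> real" where
  "outcome_vec N i \<omega> = (\<lambda>(d, r)\<in>{0, 1} \<times> {0..npeers N i}. outcome N i d r \<omega>)"

definition bit_vec_space :: "nat \<Rightarrow> (nat \<Rightarrow> nat) measure" where
  "bit_vec_space n = (\<Pi>\<^sub>M j\<in>{1..n}. count_space {0, 1})"

text \<open>
  The constant indep_var relates random variables with values in the same type; this is why D_i is
  embedded into the reals in the last clause.
\<close>

definition experimental_design :: "('u, 'w) network \<Rightarrow> bool" where
  "experimental_design N \<longleftrightarrow>
     prob_space.indep_vars (pspace N) (\<lambda>_. count_space {0, 1}) (treat N)
       (focal N \<union> peer_sample N) \<and>
     (\<forall>i\<in>focal N. \<forall>d\<in>{0, 1}.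
        measure (pspace N) {\<omega> \<in> space (pspace N). treat N i \<omega> = d} = p_focal N d) \<and>
     (\<forall>j\<in>peer_sample N. \<forall>d\<in>{0, 1}.
        measure (pspace N) {\<omega> \<in> space (pspace N). treat N j \<omega> = d} = p_peer N d) \<and>
     (\<forall>i\<in>focal N. \<forall>d\<in>{0, 1}. \<forall>r\<in>{0..npeers N i}.
        prob_space.indep_var (pspace N)
          (count_space {0, 1 :: real} \<Otimes>\<^sub>M bit_vec_space (npeers N i))
          (\<lambda>\<omega>. (real (treat N i \<omega>), peer_treat_vec N i \<omega>))
          (borel \<Otimes>\<^sub>M bit_vec_space (npeers N i))
          (\<lambda>\<omega>. (outcome N i d r \<omega>, link_vec N i \<omega>)))"

definition independent_units :: "('u, 'w) network \<Rightarrow> bool" where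
  "independent_units N \<longleftrightarrow>
     prob_space.indep_vars (pspace N)
       (\<lambda>i. (\<Pi>\<^sub>M (d, r)\<in>{0, 1} \<times> {0..npeers N i}. borel) \<Otimes>\<^sub>M bit_vec_space (npeers N i))
       (\<lambda>i \<omega>. (outcome_vec N i \<omega>, link_vec N i \<omega>)) (focal N)"

definition treated_peers :: "('u, 'w) network \<Rightarrow> 'u \<Rightarrow> 'w \<Rightarrow> nat" where
  "treated_peers N i \<omega> = (\<Sum>j = 1..npeers N i. link N i j \<omega> * treat N (peer N i j) \<omega>)"

text \<open>The random variable R_i(d): the treatment of the first peer is set to d.\<close>

definition pot_treated_peers :: "('u, 'w) network \<Rightarrow> 'u \<Rightarrow> nat \<Rightarrow> 'w \<Rightarrow> nat" where
  "pot_treated_peers N i d \<omega> =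
     link N i 1 \<omega> * d + (\<Sum>j = 2..npeers N i. link N i j \<omega> * treat N (peer N i j) \<omega>)"

definition observed_outcome :: "('u, 'w) network \<Rightarrow> 'u \<Rightarrow> 'w \<Rightarrow> real" where
  "observed_outcome N i \<omega> =
     (\<Sum>(d, r)\<in>{0, 1} \<times> {0..npeers N i}.
        of_bool (treat N i \<omega> = d \<and> treated_peers N i \<omega> = r) * outcome N i d r \<omega>)"

definition first_stage :: "('u, 'w) network \<Rightarrow> real \<times> real \<times> real \<Rightarrow> real" where
  "first_stage N = (\<lambda>(a0, ad, as). \<Sum>i\<in>focal N. \<integral>\<omega>.
     (aggr N i (treated_peers N i \<omega>) - a0 - ad * real (treat N i \<omega>)
        - as * real (treat N (peer N i 1) \<omega>))\<^sup>2 \<partial>pspace N)"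

definition linear_projection ::
  "('u, 'w) network \<Rightarrow> real \<times> real \<times> real \<Rightarrow> 'u \<Rightarrow> 'w \<Rightarrow> real" where
  "linear_projection N = (\<lambda>(g0, gd, gs) i \<omega>.
     g0 + gd * real (treat N i \<omega>) + gs * real (treat N (peer N i 1) \<omega>))"

definition second_stage ::
  "('u, 'w) network \<Rightarrow> real \<times> real \<times> real \<Rightarrow> real \<times> real \<times> real \<Rightarrow> real" where
  "second_stage N g = (\<lambda>(b0, bd, bs). \<Sum>i\<in>focal N. \<integral>\<omega>.
     (observed_outcome N i \<omega> - b0 - bd * real (treat N i \<omega>)
        - bs * linear_projection N g i \<omega>)\<^sup>2 \<partial>pspace N)"

definition is_unique_arg_min :: "('a \<Rightarrow> real) \<Rightarrow> 'a \<Rightarrow> bool" where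
  "is_unique_arg_min f x \<longleftrightarrow>
     is_arg_min f (\<lambda>_. True) x \<and> (\<forall>y. is_arg_min f (\<lambda>_. True) y \<longrightarrow> y = x)"

definition tau :: "('u, 'w) network \<Rightarrow> 'u \<Rightarrow> nat \<Rightarrow> nat \<Rightarrow> 'w \<Rightarrow> real" where
  "tau N i d r \<omega> = outcome N i d r \<omega> - outcome N i d (r - 1) \<omega>"

definition tau_bar :: "('u, 'w) network \<Rightarrow> 'u \<Rightarrow> nat \<Rightarrow> 'w \<Rightarrow> real" where
  "tau_bar N i r \<omega> = tau N i 1 r \<omega> * p_focal N 1 + tau N i 0 r \<omega> * p_focal N 0"

definition complier_event :: "('u, 'w) network \<Rightarrow> 'u \<Rightarrow> nat \<Rightarrow> 'w set" where
  "complier_event N i r =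
     {\<omega> \<in> space (pspace N). pot_treated_peers N i 1 \<omega> \<ge> r \<and> r > pot_treated_peers N i 0 \<omega>}"

text \<open>Expectation conditional on an event; it is 0 when the event has probability 0.\<close>

definition cond_expectation :: "'w measure \<Rightarrow> ('w \<Rightarrow> real) \<Rightarrow> 'w set \<Rightarrow> real" where
  "cond_expectation P X E = (LINT \<omega>:E|P. X \<omega>) / measure P E"

definition pot_aggr :: "('u, 'w) network \<Rightarrow> 'u \<Rightarrow> nat \<Rightarrow> 'w \<Rightarrow> real" where
  "pot_aggr N i d \<omega> = aggr N i (pot_treated_peers N i d \<omega>)"

definition weight :: "('u, 'w) network \<Rightarrow> 'u \<Rightarrow> nat \<Rightarrow> real" where
  "weight N i r =
     measure (pspace N) (complier_event N i r) /
     (1 / real (card (focal N)) *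
       (\<Sum>k\<in>focal N. \<integral>\<omega>. (pot_aggr N k 1 \<omega> - pot_aggr N k 0 \<omega>) \<partial>pspace N))"

end

theory Submission
  imports Defs
begin

text \<open>
  Let p be the treatment probability of the peers.  Shifting the coefficients along the centred
  instrument D_{1(i)} - p shows that the estimand is the ratio of the summed covariances of the
  outcome and of M_i with the instrument; uniqueness of the second-stage minimizer forces the
  denominator to be nonzero.  Given the links, R_i(d) depends only on the treatments of the other
  peers, so each covariance is p (1 - p) times the mean effect of switching R_i from R_i(0) to R_i(1),
  and that effect telescopes over the thresholds r with R_i(1) \<ge> r > R_i(0).
\<close>

section \<open>Bounded multiples and the quadratic loss\<close>

text \<open>Two features of the design shape the argument. Independence from the treatments is
  granted for one pair (d, r) at a time, jointly with the links, and not for the whole family of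
  potential outcomes; so moments are computed cell by cell and reassembled into a value at R_i(s)
  only at the end. And R_i(s) mixes treatments with links that may depend on the outcomes, so it
  lies on neither side of the independence; this forces the finite sum over link vectors. One
  direction suffices in place of the full normal equations because p is common to all peers and D_i
  is independent of the instrument: the single coefficient vector (-p, 0, 1) is orthogonal to 1 and
  D_i in every unit at once. Both stages share one loss, since the first-stage fit is affine in D_i
  and the instrument.\<close>

lemma integrable_mult_bounded:
  fixes f g :: "'a \<Rightarrow> real"
  assumes f: "integrable M f" and g: "g \<in> borel_measurable M"
    and bound: "\<And>x. x \<in> space M \<Longrightarrow> \<bar>g x\<bar> \<le> B"
  shows "integrable M (\<lambda>x. f x * g x)"
proof (rule Bochner_Integration.integrable_bound)
  show "integrable M (\<lambda>x. B * f x)" using f by simp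
  show "(\<lambda>x. f x * g x) \<in> borel_measurable M" using f g by measurable
  show "AE x in M. norm (f x * g x) \<le> norm (B * f x)"
  proof (rule AE_I2)
    fix x assume "x \<in> space M"
    then have "\<bar>g x\<bar> \<le> \<bar>B\<bar>" using bound[of x] by linarith
    then have "\<bar>f x\<bar> * \<bar>g x\<bar> \<le> \<bar>f x\<bar> * \<bar>B\<bar>" by (rule mult_left_mono) simp
    then show "norm (f x * g x) \<le> norm (B * f x)" by (simp add: abs_mult mult.commute)
  qed
qed

lemma integrable_of_bool_mult:
  fixes f :: "'a \<Rightarrow> real"
  assumes "integrable M f" "Measurable.pred M P"
  shows "integrable M (\<lambda>x. of_bool (P x) * f x)"
proof -
  have "(\<lambda>x. of_bool (P x) :: real) \<in> borel_measurable M" using assms(2) by measurable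
  then have "integrable M (\<lambda>x. f x * of_bool (P x))"
    by (rule integrable_mult_bounded[OF assms(1), where B = 1]) simp
  then show ?thesis by (simp add: mult.commute)
qed

text \<open>First-order condition for a quadratic in t that is minimal at t = 0, obtained without
  derivatives. \<open>C\<close> may vanish, as it does when the instrument is degenerate.\<close>

lemma linear_coefficient_eq_zero:
  fixes B C :: real
  assumes "\<And>t. 0 \<le> t\<^sup>2 * C - 2 * t * B"
  shows "B = 0"
proof (rule ccontr)
  assume "B \<noteq> 0"
  \<comment> \<open>The vertex B / C may be undefined; with |C| + 1 in the denominator the quadratic
    equals \<open>t\<^sup>2 * (C - 2 * (\<bar>C\<bar> + 1))\<close>, which is negative for B
    \<noteq> 0.\<close>
  define t where "t = B / (\<bar>C\<bar> + 1)"
  have pos: "\<bar>C\<bar> + 1 > 0" by simp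
  then have "t * (\<bar>C\<bar> + 1) = B" by (simp add: t_def)
  then have "t * B = t\<^sup>2 * (\<bar>C\<bar> + 1)"
    by (simp add: power2_eq_square mult.assoc)
  then have "0 \<le> t\<^sup>2 * (C - 2 * (\<bar>C\<bar> + 1))" using assms[of t] by (simp add: algebra_simps)
  moreover have "t\<^sup>2 > 0" using \<open>B \<noteq> 0\<close> pos by (simp add: t_def)
  ultimately have "0 \<le> C - 2 * (\<bar>C\<bar> + 1)" by (simp add: zero_le_mult_iff)
  then show False by (simp add: abs_if split: if_splits)
qed

section \<open>Binary treatments, their marginal laws and the instrument\<close>

locale designed_network = network_model +
  assumes design: "experimental_design N"
begin

abbreviation instrument :: "'a \<Rightarrow> 'b \<Rightarrow> nat" where
  "instrument i \<equiv> treat N (peer N i 1)"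

text \<open>Common form of both objectives: \<open>W\<close> is the aggregate in the first stage and
  the observed outcome in the second, where the coefficients are reparametrized.\<close>

definition loss :: "('a \<Rightarrow> 'b \<Rightarrow> real) \<Rightarrow> real \<Rightarrow> real \<Rightarrow> real \<Rightarrow> real" where
  "loss W c0 cd cs = (\<Sum>i\<in>focal N. \<integral>\<omega>.
     (W i \<omega> - c0 - cd * real (treat N i \<omega>) - cs * real (instrument i \<omega>))\<^sup>2 \<partial>pspace N)"

definition instrument_variance :: real where
  "instrument_variance = p_peer N 1 * (1 - p_peer N 1)"

text \<open>Centring one factor is enough for a covariance, since the instrument has mean
  \<open>p_peer N 1\<close>.\<close>

definition instrument_cov :: "('a \<Rightarrow> 'b \<Rightarrow> real) \<Rightarrow> 'a \<Rightarrow> real" where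
  "instrument_cov W i = expectation (\<lambda>\<omega>. W i \<omega> * (real (instrument i \<omega>) - p_peer N 1))"

lemma peer_in_sample: "i \<in> focal N \<Longrightarrow> j \<in> {1..npeers N i} \<Longrightarrow> peer N i j \<in> peer_sample N"
  using potential_peers_subset[of i] by (force simp: potential_peers_def)

lemma first_peer_in_sample: "i \<in> focal N \<Longrightarrow> peer N i 1 \<in> peer_sample N"
  using peer_in_sample[of i 1] npeers_ge_1[of i] by simp

text \<open>The model takes \<open>count_space {0, 1}\<close> as target; sums, products and
  arbitrary predicates of the bits are handled in \<open>count_space UNIV\<close>.\<close>

lemma measurable_into_UNIV:
  "f \<in> measurable M (count_space A) \<Longrightarrow> f \<in> measurable M (count_space UNIV)"
  by (rule measurable_compose[where g = "\<lambda>x. x"]) auto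

lemma treat_measurable:
  "k \<in> focal N \<union> peer_sample N \<Longrightarrow> random_variable (count_space UNIV) (treat N k)"
  using random_treat measurable_into_UNIV by blast

lemma link_measurable:
  "i \<in> focal N \<Longrightarrow> j \<in> {1..npeers N i} \<Longrightarrow> random_variable (count_space UNIV) (link N i j)"
  using random_link measurable_into_UNIV by blast

lemma treat_binary:
  "k \<in> focal N \<union> peer_sample N \<Longrightarrow> \<omega> \<in> space (pspace N) \<Longrightarrow> treat N k \<omega> \<in> {0, 1}"
  using measurable_space[OF random_treat] by fastforce

lemma link_binary:
  "i \<in> focal N \<Longrightarrow> j \<in> {1..npeers N i} \<Longrightarrow> \<omega> \<in> space (pspace N) \<Longrightarrow> link N i j \<omega> \<in> {0, 1}"
  using measurable_space[OF random_link] by fastforce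

lemma expectation_of_bool:
  "{\<omega> \<in> space (pspace N). P \<omega>} \<in> events \<Longrightarrow>
    expectation (\<lambda>\<omega>. of_bool (P \<omega>)) = prob {\<omega> \<in> space (pspace N). P \<omega>}"
proof -
  assume *: "{\<omega> \<in> space (pspace N). P \<omega>} \<in> events"
  have "expectation (\<lambda>\<omega>. of_bool (P \<omega>))
    = expectation (indicator {\<omega> \<in> space (pspace N). P \<omega>} :: 'b \<Rightarrow> real)"
    by (rule Bochner_Integration.integral_cong) (auto simp: indicator_def)
  then show ?thesis using * by simp
qed

lemma prob_treat_focal:
  "i \<in> focal N \<Longrightarrow> d \<in> {0, 1} \<Longrightarrow> expectation (\<lambda>\<omega>. of_bool (treat N i \<omega> = d)) = p_focal N d"
  using design treat_measurable[of i] unfolding experimental_design_def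
  by (subst expectation_of_bool) auto

lemma prob_treat_peer:
  "j \<in> peer_sample N \<Longrightarrow> d \<in> {0, 1} \<Longrightarrow> expectation (\<lambda>\<omega>. of_bool (treat N j \<omega> = d)) = p_peer N d"
  using design treat_measurable[of j] unfolding experimental_design_def
  by (subst expectation_of_bool) auto

lemma integrable_bounded:
  fixes g :: "'b \<Rightarrow> real"
  shows "random_variable borel g \<Longrightarrow> (\<And>x. x \<in> space (pspace N) \<Longrightarrow> \<bar>g x\<bar> \<le> B) \<Longrightarrow>
    integrable (pspace N) g"
  by (rule integrable_const_bound[where B = B]) auto

lemma expectation_treat:
  assumes "k \<in> focal N \<union> peer_sample N"
  shows "expectation (\<lambda>\<omega>. real (treat N k \<omega>)) = expectation (\<lambda>\<omega>. of_bool (treat N k \<omega> = 1))"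
  using treat_binary[OF assms] by (intro Bochner_Integration.integral_cong) fastforce+

lemma p_sum_one:
  assumes k: "k \<in> focal N \<union> peer_sample N"
  shows "expectation (\<lambda>\<omega>. of_bool (treat N k \<omega> = 0) :: real)
    = 1 - expectation (\<lambda>\<omega>. of_bool (treat N k \<omega> = 1))"
proof -
  note [measurable] = treat_measurable[OF k]
  have "expectation (\<lambda>\<omega>. of_bool (treat N k \<omega> = 0) :: real)
      = expectation (\<lambda>\<omega>. 1 - of_bool (treat N k \<omega> = 1))"
    using treat_binary[OF k] by (intro Bochner_Integration.integral_cong) fastforce+
  also have "\<dots> = 1 - expectation (\<lambda>\<omega>. of_bool (treat N k \<omega> = 1))"
  proof -
    have "integrable (pspace N) (\<lambda>\<omega>. of_bool (treat N k \<omega> = 1) * (1 :: real))"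
      by (rule integrable_of_bool_mult) (simp, measurable)
    then show ?thesis by (simp add: prob_space)
  qed
  finally show ?thesis .
qed

lemma p_focal_0: "i \<in> focal N \<Longrightarrow> p_focal N 0 = 1 - p_focal N 1"
  using p_sum_one[of i] prob_treat_focal[of i 0] prob_treat_focal[of i 1] by simp

lemma p_peer_0: "j \<in> peer_sample N \<Longrightarrow> p_peer N 0 = 1 - p_peer N 1"
  using p_sum_one[of j] prob_treat_peer[of j 0] prob_treat_peer[of j 1] by simp

section \<open>Factorization over treatments and links\<close>

text \<open>The links enter as a fixed vector \<open>a\<close>, which makes this a function of
  treatments alone. The sum starts at 2 so that the instrument stays out of it.\<close>

definition other_treated :: "'a \<Rightarrow> (nat \<Rightarrow> nat) \<Rightarrow> 'b \<Rightarrow> nat" where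
  "other_treated i a \<omega> = (\<Sum>j = 2..npeers N i. a j * treat N (peer N i j) \<omega>)"

lemma treated_peers_eq:
  assumes i: "i \<in> focal N"
  shows "treated_peers N i \<omega> = pot_treated_peers N i (instrument i \<omega>) \<omega>"
  using npeers_ge_1[OF i]
  by (simp add: treated_peers_def pot_treated_peers_def sum.atLeast_Suc_atMost numeral_2_eq_2)

lemma pot_treated_peers_eq:
  assumes i: "i \<in> focal N"
  shows "pot_treated_peers N i d \<omega> = link_vec N i \<omega> 1 * d + other_treated i (link_vec N i \<omega>) \<omega>"
  using npeers_ge_1[OF i] by (simp add: pot_treated_peers_def other_treated_def link_vec_def)

lemma other_treated_measurable:
  "i \<in> focal N \<Longrightarrow> random_variable (count_space UNIV) (other_treated i a)"
  unfolding other_treated_def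
  using treat_measurable peer_in_sample by (intro measurable_sum_nat) auto

text \<open>Mutually independent treatments stay independent when grouped into disjoint blocks: the
  focal unit, its first peer, its other peers. The blocks are disjoint because the two samples are
  and because \<open>peer N i\<close> is injective.\<close>

lemma treatments_factor:
  assumes i: "i \<in> focal N"
  shows "expectation (\<lambda>\<omega>. of_bool (treat N i \<omega> = d) * of_bool (instrument i \<omega> = s) *
        of_bool (Q (other_treated i a \<omega>)) :: real)
    = expectation (\<lambda>\<omega>. of_bool (treat N i \<omega> = d)) * expectation (\<lambda>\<omega>. of_bool (instrument i \<omega> = s)) *
      expectation (\<lambda>\<omega>. of_bool (Q (other_treated i a \<omega>)))"
proof -
  \<comment> \<open>The third block is empty for a unit with a single peer; the corresponding sum is
    then the constant 0.\<close>
  define K where "K = (\<lambda>l::nat. if l = 0 then {i} else if l = 1 then {peer N i 1}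
      else peer N i ` {2..npeers N i})"
  define F :: "nat \<Rightarrow> ('a \<Rightarrow> nat) \<Rightarrow> real" where
    "F = (\<lambda>l x. if l = 0 then of_bool (x i = d) else if l = 1 then of_bool (x (peer N i 1) = s)
      else of_bool (Q (\<Sum>j = 2..npeers N i. a j * x (peer N i j))))"
  have ne: "i \<noteq> peer N i j" if "j \<in> {1..npeers N i}" for j
    using peer_in_sample[OF i that] disjoint_samples i by auto
  have ne': "peer N i 1 \<noteq> peer N i j" if "j \<in> {2..npeers N i}" for j
    using inj_onD[OF inj_peer[OF i], of 1 j] that npeers_ge_1[OF i] by auto
  have disj: "disjoint_family_on K {0, 1, 2}"
    using ne ne' npeers_ge_1[OF i] unfolding disjoint_family_on_def K_def by fastforce
  have sub: "K l \<subseteq> focal N \<union> peer_sample N" for l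
    using i peer_in_sample[OF i] npeers_ge_1[OF i] by (auto simp: K_def)
  have "indep_vars (\<lambda>_. count_space {0, 1}) (treat N) (focal N \<union> peer_sample N)"
    using design by (simp add: experimental_design_def)
  then have "indep_vars (\<lambda>l. \<Pi>\<^sub>M k\<in>K l. count_space {0, 1}) (\<lambda>l \<omega>. \<lambda>k\<in>K l. treat N k \<omega>) {0, 1, 2}"
    by (rule indep_vars_restrict) (use sub disj in auto)
  then have iv: "indep_vars (\<lambda>l. borel) (\<lambda>l \<omega>. F l (\<lambda>k\<in>K l. treat N k \<omega>)) {0, 1, 2}"
  proof (rule indep_vars_compose2)
    fix l :: nat assume "l \<in> {0, 1, 2}"
    have comp: "(\<lambda>x. x k) \<in> measurable (\<Pi>\<^sub>M k\<in>K l. count_space {0, 1::nat}) (count_space UNIV)"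
      if "k \<in> K l" for k
      using that by (intro measurable_into_UNIV[where A = "{0, 1}"] measurable_component_singleton)
    consider "l = 0" | "l = 1" | "l = 2" using \<open>l \<in> {0, 1, 2}\<close> by auto
    then show "F l \<in> borel_measurable (\<Pi>\<^sub>M k\<in>K l. count_space {0, 1})"
    proof cases
      case 1
      have [measurable]: "(\<lambda>x. x i) \<in> measurable (\<Pi>\<^sub>M k\<in>K l. count_space {0, 1::nat}) (count_space UNIV)"
        by (rule comp) (simp add: 1 K_def)
      have eq: "F l = (\<lambda>x. of_bool (x i = d))" using 1 by (simp add: F_def fun_eq_iff)
      show ?thesis unfolding eq by measurable
    next
      case 2
      have [measurable]: "(\<lambda>x. x (peer N i 1)) \<in> measurable (\<Pi>\<^sub>M k\<in>K l. count_space {0, 1::nat}) (count_space UNIV)"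
        by (rule comp) (simp add: 2 K_def)
      have eq: "F l = (\<lambda>x. of_bool (x (peer N i 1) = s))" using 2 by (simp add: F_def fun_eq_iff)
      show ?thesis unfolding eq by measurable
    next
      case 3
      have [measurable]: "(\<lambda>x. \<Sum>j = 2..npeers N i. a j * x (peer N i j))
          \<in> measurable (\<Pi>\<^sub>M k\<in>K l. count_space {0, 1::nat}) (count_space UNIV)"
      proof (rule measurable_sum_nat)
        fix j assume "j \<in> {2..npeers N i}"
        then have "(\<lambda>x. x (peer N i j)) \<in> measurable (\<Pi>\<^sub>M k\<in>K l. count_space {0, 1::nat}) (count_space UNIV)"
          by (intro comp) (simp add: 3 K_def)
        then show "(\<lambda>x. a j * x (peer N i j)) \<in> measurable (\<Pi>\<^sub>M k\<in>K l. count_space {0, 1::nat}) (count_space UNIV)"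
          by (rule measurable_compose[where g = "\<lambda>v. a j * v"]) simp
      qed
      have eq: "F l = (\<lambda>x. of_bool (Q (\<Sum>j = 2..npeers N i. a j * x (peer N i j))))"
        using 3 by (simp add: F_def fun_eq_iff)
      show ?thesis unfolding eq by measurable
    qed
  qed
  have prod: "expectation (\<lambda>\<omega>. \<Prod>l\<in>{0, 1, 2}. F l (\<lambda>k\<in>K l. treat N k \<omega>))
      = (\<Prod>l\<in>{0, 1, 2}. expectation (\<lambda>\<omega>. F l (\<lambda>k\<in>K l. treat N k \<omega>)))"
  proof (rule indep_vars_lebesgue_integral[OF _ iv])
    fix l :: nat assume l: "l \<in> {0, 1, 2}"
    show "integrable (pspace N) (\<lambda>\<omega>. F l (\<lambda>k\<in>K l. treat N k \<omega>))"
      using iv l by (intro integrable_bounded[where B = 1]) (auto simp: indep_vars_def F_def)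
  qed simp
  have F: "F 0 (\<lambda>k\<in>K 0. treat N k \<omega>) = of_bool (treat N i \<omega> = d)"
    "F (Suc 0) (\<lambda>k\<in>K (Suc 0). treat N k \<omega>) = of_bool (instrument i \<omega> = s)"
    "F 2 (\<lambda>k\<in>K 2. treat N k \<omega>) = of_bool (Q (other_treated i a \<omega>))" for \<omega>
    by (simp_all add: F_def K_def other_treated_def)
  show ?thesis using prod by (simp add: F mult.assoc)
qed

lemma link_vec_in_PiE:
  assumes "i \<in> focal N" "\<omega> \<in> space (pspace N)"
  shows "link_vec N i \<omega> \<in> {1..npeers N i} \<rightarrow>\<^sub>E {0, 1}"
  unfolding link_vec_def using link_binary[OF assms(1) _ assms(2)] by (intro restrict_PiE_iff[THEN iffD2]) blast

text \<open>Last clause of the design with an arbitrary \<open>Z\<close> in place of the potential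
  outcome, so that one argument covers both Y_i(d, r) and the constant M_i(r).\<close>

definition independent_of_treatments :: "'a \<Rightarrow> ('b \<Rightarrow> real) \<Rightarrow> bool" where
  "independent_of_treatments i Z \<longleftrightarrow> indep_var
     (count_space {0, 1 :: real} \<Otimes>\<^sub>M bit_vec_space (npeers N i))
     (\<lambda>\<omega>. (real (treat N i \<omega>), peer_treat_vec N i \<omega>))
     (borel \<Otimes>\<^sub>M bit_vec_space (npeers N i)) (\<lambda>\<omega>. (Z \<omega>, link_vec N i \<omega>))"

text \<open>Link vectors are restricted functions: a non-extensional \<open>a\<close> is never
  attained, and for an extensional one equality reduces to finitely many coordinate tests.\<close>

lemma link_vec_eq_measurable:
  assumes i: "i \<in> focal N"
  shows "Measurable.pred (pspace N) (\<lambda>\<omega>. link_vec N i \<omega> = a)"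
proof (cases "a \<in> extensional {1..npeers N i}")
  case False
  then have "link_vec N i \<omega> \<noteq> a" for \<omega> by (auto simp: link_vec_def)
  then show ?thesis by simp
next
  case True
  have eq: "link_vec N i \<omega> = a \<longleftrightarrow> (\<forall>j\<in>{1..npeers N i}. link N i j \<omega> = a j)" for \<omega>
    using True by (auto simp: link_vec_def extensional_def)
  show ?thesis unfolding eq
  proof (rule pred_intros_finite)
    fix j assume "j \<in> {1..npeers N i}"
    then have [measurable]: "random_variable (count_space UNIV) (link N i j)"
      by (rule link_measurable[OF i])
    show "Measurable.pred (pspace N) (\<lambda>\<omega>. link N i j \<omega> = a j)" by measurable
  qed simp
qed

text \<open>With \<open>a\<close> fixed, the first factor is a function of the treatments and the
  second of (Z, links). The design separates these two groups, however Z and the links depend on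
  each other.\<close>

lemma links_factor:
  fixes P R Q :: "nat \<Rightarrow> bool"
  assumes i: "i \<in> focal N" and Z: "independent_of_treatments i Z" and int: "integrable (pspace N) Z"
  shows "expectation (\<lambda>\<omega>. of_bool (P (treat N i \<omega>) \<and> R (instrument i \<omega>) \<and> Q (other_treated i a \<omega>)) *
        (of_bool (link_vec N i \<omega> = a) * Z \<omega>))
    = expectation (\<lambda>\<omega>. of_bool (P (treat N i \<omega>) \<and> R (instrument i \<omega>) \<and> Q (other_treated i a \<omega>))) *
      expectation (\<lambda>\<omega>. of_bool (link_vec N i \<omega> = a) * Z \<omega>)"
proof (cases "a \<in> extensional {1..npeers N i}")
  case False
  then have "link_vec N i \<omega> \<noteq> a" for \<omega> by (auto simp: link_vec_def)
  then show ?thesis by simp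
next
  case True
  let ?n = "npeers N i" and ?B = "bit_vec_space (npeers N i)"
  have comp: "(\<lambda>y. y j) \<in> measurable ?B (count_space UNIV)" if "j \<in> {1..?n}" for j
    using that unfolding bit_vec_space_def
    by (intro measurable_into_UNIV[where A = "{0, 1}"] measurable_component_singleton)
  have "Measurable.pred ?B (\<lambda>y. \<forall>j\<in>{1..?n}. y j = a j)"
  proof (rule pred_intros_finite)
    fix j assume "j \<in> {1..?n}"
    note [measurable] = comp[OF this]
    show "Measurable.pred ?B (\<lambda>y. y j = a j)" by measurable
  qed simp
  note [measurable] = measurable_compose[OF measurable_snd this]
  have g: "(\<lambda>(z, y). of_bool (\<forall>j\<in>{1..?n}. y j = a j) * (z :: real)) \<in> borel_measurable (borel \<Otimes>\<^sub>M ?B)"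
    unfolding case_prod_beta by measurable
  \<comment> \<open>\<open>nat \<lfloor>fst x\<rfloor>\<close> undoes the embedding of D_i into the
    reals made in the design.\<close>
  define f :: "real \<times> (nat \<Rightarrow> nat) \<Rightarrow> real" where
    "f = (\<lambda>x. of_bool (P (nat \<lfloor>fst x\<rfloor>) \<and> R (snd x 1) \<and> Q (\<Sum>j = 2..?n. a j * snd x j)))"
  have "(\<lambda>x. nat \<lfloor>x\<rfloor>) \<in> measurable (count_space {0, 1 :: real}) (count_space UNIV)" by simp
  note [measurable] = measurable_compose[OF measurable_fst this]
  have [measurable]: "(\<lambda>x. snd x 1) \<in> measurable (count_space {0, 1 :: real} \<Otimes>\<^sub>M ?B) (count_space UNIV)"
    using npeers_ge_1[OF i] by (intro measurable_compose[OF measurable_snd comp]) simp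
  have [measurable]: "(\<lambda>x. \<Sum>j = 2..?n. a j * snd x j)
      \<in> measurable (count_space {0, 1 :: real} \<Otimes>\<^sub>M ?B) (count_space UNIV)"
  proof (rule measurable_sum_nat)
    fix j assume "j \<in> {2..?n}"
    then have [measurable]: "(\<lambda>x. snd x j) \<in> measurable (count_space {0, 1 :: real} \<Otimes>\<^sub>M ?B) (count_space UNIV)"
      by (intro measurable_compose[OF measurable_snd comp]) simp
    show "(\<lambda>x. a j * snd x j) \<in> measurable (count_space {0, 1 :: real} \<Otimes>\<^sub>M ?B) (count_space UNIV)"
      by measurable
  qed
  have f: "f \<in> borel_measurable (count_space {0, 1} \<Otimes>\<^sub>M ?B)" unfolding f_def by measurable
  have eq: "(\<forall>j\<in>{1..?n}. link_vec N i \<omega> j = a j) \<longleftrightarrow> link_vec N i \<omega> = a" for \<omega>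
    using True by (auto simp: link_vec_def extensional_def)
  have feq: "f (real (treat N i \<omega>), peer_treat_vec N i \<omega>) =
      of_bool (P (treat N i \<omega>) \<and> R (instrument i \<omega>) \<and> Q (other_treated i a \<omega>))" for \<omega>
    using npeers_ge_1[OF i] by (simp add: f_def peer_treat_vec_def other_treated_def)
  have iv: "indep_var
      borel (\<lambda>\<omega>. of_bool (P (treat N i \<omega>) \<and> R (instrument i \<omega>) \<and> Q (other_treated i a \<omega>)))
      borel (\<lambda>\<omega>. of_bool (link_vec N i \<omega> = a) * Z \<omega>)"
    using indep_var_compose[OF Z[unfolded independent_of_treatments_def] f g]
    unfolding comp_def feq prod.case eq .
  show ?thesis
  proof (rule indep_var_lebesgue_integral[OF iv])
    show "integrable (pspace N)
        (\<lambda>\<omega>. of_bool (P (treat N i \<omega>) \<and> R (instrument i \<omega>) \<and> Q (other_treated i a \<omega>)) :: real)"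
      using indep_var_rv1[OF iv] by (rule integrable_bounded[where B = 1]) simp
    have "(\<lambda>\<omega>. of_bool (link_vec N i \<omega> = a) * Z \<omega>) \<in> borel_measurable (pspace N)"
      by (rule indep_var_rv2[OF iv])
    then show "integrable (pspace N) (\<lambda>\<omega>. of_bool (link_vec N i \<omega> = a) * Z \<omega>)"
      by (rule Bochner_Integration.integrable_bound[OF int]) auto
  qed
qed

lemma link_treat_measurable:
  assumes i: "i \<in> focal N" and j: "j \<in> {1..npeers N i}"
  shows "random_variable (count_space UNIV) (\<lambda>\<omega>. link N i j \<omega> * treat N (peer N i j) \<omega>)"
proof -
  note [measurable] = link_measurable[OF i j]
  have [measurable]: "random_variable (count_space UNIV) (treat N (peer N i j))"
    using peer_in_sample[OF i j] by (intro treat_measurable) simp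
  show ?thesis by measurable
qed

lemma treated_peers_measurable:
  "i \<in> focal N \<Longrightarrow> random_variable (count_space UNIV) (treated_peers N i)"
  unfolding treated_peers_def by (intro measurable_sum_nat link_treat_measurable)

lemma pot_treated_peers_measurable:
  assumes i: "i \<in> focal N"
  shows "random_variable (count_space UNIV) (pot_treated_peers N i d)"
proof -
  have [measurable]: "random_variable (count_space UNIV) (link N i 1)"
    using npeers_ge_1[OF i] by (intro link_measurable[OF i]) simp
  have [measurable]: "random_variable (count_space UNIV)
      (\<lambda>\<omega>. \<Sum>j = 2..npeers N i. link N i j \<omega> * treat N (peer N i j) \<omega>)"
    by (intro measurable_sum_nat link_treat_measurable[OF i]) simp
  show ?thesis unfolding pot_treated_peers_def by measurable
qed

text \<open>Conditioning on the link vector a turns R_i(s) into the sum s * a 1 + other_treated i a, which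
  involves treatments only; then the design separates it from D_i and from the instrument.\<close>

lemma potential_moment:
  assumes i: "i \<in> focal N" and Z: "independent_of_treatments i Z" and int: "integrable (pspace N) Z"
  shows "expectation (\<lambda>\<omega>. of_bool (treat N i \<omega> = d \<and> instrument i \<omega> = s \<and> pot_treated_peers N i s \<omega> = r) * Z \<omega>)
    = expectation (\<lambda>\<omega>. of_bool (treat N i \<omega> = d)) * expectation (\<lambda>\<omega>. of_bool (instrument i \<omega> = s)) *
      expectation (\<lambda>\<omega>. of_bool (pot_treated_peers N i s \<omega> = r) * Z \<omega>)"
proof -
  let ?A = "{1..npeers N i} \<rightarrow>\<^sub>E {0, 1 :: nat}"
  let ?Q = "\<lambda>a q. a 1 * s + q = r"
  have fin: "finite ?A" by (rule finite_PiE) auto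
  note [measurable] = link_vec_eq_measurable[OF i] other_treated_measurable[OF i]
  have [measurable]: "random_variable (count_space UNIV) (treat N i)"
    "random_variable (count_space UNIV) (instrument i)"
    using i first_peer_in_sample[OF i] by (auto intro: treat_measurable)
  have [measurable]: "Z \<in> borel_measurable (pspace N)" using int by simp
  \<comment> \<open>Stated for arbitrary tests \<open>P\<close> and \<open>R\<close> because it is
    used twice: with the tests for d and s, and with trivial tests. Term by term the two expansions
    differ by the factor Pr(D_i = d) Pr(D_{1(i)} = s), which does not depend on \<open>a\<close> and
    leaves the sum.\<close>
  have expand: "expectation (\<lambda>\<omega>. of_bool (P (treat N i \<omega>) \<and> R (instrument i \<omega>) \<and> pot_treated_peers N i s \<omega> = r) * Z \<omega>)
      = (\<Sum>a\<in>?A. expectation (\<lambda>\<omega>. of_bool (P (treat N i \<omega>) \<and> R (instrument i \<omega>) \<and> ?Q a (other_treated i a \<omega>))) *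
          expectation (\<lambda>\<omega>. of_bool (link_vec N i \<omega> = a) * Z \<omega>))" for P R :: "nat \<Rightarrow> bool"
  proof -
    have "expectation (\<lambda>\<omega>. of_bool (P (treat N i \<omega>) \<and> R (instrument i \<omega>) \<and> pot_treated_peers N i s \<omega> = r) * Z \<omega>)
      = expectation (\<lambda>\<omega>. \<Sum>a\<in>?A. of_bool (P (treat N i \<omega>) \<and> R (instrument i \<omega>) \<and> ?Q a (other_treated i a \<omega>)) *
          (of_bool (link_vec N i \<omega> = a) * Z \<omega>))"
    proof (rule Bochner_Integration.integral_cong[OF refl])
      fix \<omega> assume "\<omega> \<in> space (pspace N)"
      then have mem: "link_vec N i \<omega> \<in> ?A" by (rule link_vec_in_PiE[OF i])
      have "(\<Sum>a\<in>?A. of_bool (P (treat N i \<omega>) \<and> R (instrument i \<omega>) \<and> ?Q a (other_treated i a \<omega>)) *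
          (of_bool (link_vec N i \<omega> = a) * Z \<omega>))
        = (\<Sum>a\<in>?A. if link_vec N i \<omega> = a
            then of_bool (P (treat N i \<omega>) \<and> R (instrument i \<omega>) \<and> ?Q a (other_treated i a \<omega>)) * Z \<omega> else 0)"
        by (intro sum.cong) auto
      also have "\<dots> = of_bool (P (treat N i \<omega>) \<and> R (instrument i \<omega>) \<and>
          ?Q (link_vec N i \<omega>) (other_treated i (link_vec N i \<omega>) \<omega>)) * Z \<omega>"
        using fin mem by (simp add: sum.delta)
      finally show "of_bool (P (treat N i \<omega>) \<and> R (instrument i \<omega>) \<and> pot_treated_peers N i s \<omega> = r) * Z \<omega>
        = (\<Sum>a\<in>?A. of_bool (P (treat N i \<omega>) \<and> R (instrument i \<omega>) \<and> ?Q a (other_treated i a \<omega>)) *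
          (of_bool (link_vec N i \<omega> = a) * Z \<omega>))"
        unfolding pot_treated_peers_eq[OF i] by simp
    qed
    also have "\<dots> = (\<Sum>a\<in>?A. expectation (\<lambda>\<omega>.
          of_bool (P (treat N i \<omega>) \<and> R (instrument i \<omega>) \<and> ?Q a (other_treated i a \<omega>)) *
          (of_bool (link_vec N i \<omega> = a) * Z \<omega>)))"
    proof (rule Bochner_Integration.integral_sum)
      fix a
      show "integrable (pspace N) (\<lambda>\<omega>.
          of_bool (P (treat N i \<omega>) \<and> R (instrument i \<omega>) \<and> ?Q a (other_treated i a \<omega>)) *
          (of_bool (link_vec N i \<omega> = a) * Z \<omega>))"
        by (intro integrable_of_bool_mult int; measurable)
    qed
    also have "\<dots> = (\<Sum>a\<in>?A. expectation (\<lambda>\<omega>.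
          of_bool (P (treat N i \<omega>) \<and> R (instrument i \<omega>) \<and> ?Q a (other_treated i a \<omega>))) *
          expectation (\<lambda>\<omega>. of_bool (link_vec N i \<omega> = a) * Z \<omega>))"
      by (intro sum.cong refl links_factor[OF i Z int])
    finally show ?thesis .
  qed
  have "expectation (\<lambda>\<omega>. of_bool (treat N i \<omega> = d \<and> instrument i \<omega> = s \<and> ?Q a (other_treated i a \<omega>)) :: real)
      = expectation (\<lambda>\<omega>. of_bool (treat N i \<omega> = d)) * expectation (\<lambda>\<omega>. of_bool (instrument i \<omega> = s)) *
        expectation (\<lambda>\<omega>. of_bool (?Q a (other_treated i a \<omega>)))" for a
    using treatments_factor[OF i, of d s "?Q a" a] by (simp add: of_bool_conj mult.assoc)
  then show ?thesis
    using expand[of "\<lambda>x. x = d" "\<lambda>x. x = s"] expand[of "\<lambda>_. True" "\<lambda>_. True"]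
    by (simp add: sum_distrib_left mult.assoc)
qed

section \<open>Covariance of a realized outcome with the instrument\<close>

text \<open>The consistency rule defining Y_i, for any family \<open>Z\<close> of potential values.
  The family that is constant in d and in the sample point, with value M_i(r), realizes
  M_i(R_i).\<close>

definition realized :: "'a \<Rightarrow> (nat \<Rightarrow> nat \<Rightarrow> 'b \<Rightarrow> real) \<Rightarrow> 'b \<Rightarrow> real" where
  "realized i Z \<omega> = (\<Sum>(d, r)\<in>{0, 1} \<times> {0..npeers N i}.
     of_bool (treat N i \<omega> = d \<and> treated_peers N i \<omega> = r) * Z d r \<omega>)"

text \<open>At most one summand is active, and none when the values are out of range, hence the
  default 0. It makes the formula valid at every point, also outside the sample space.\<close>

lemma realized_eq:
  "realized i Z \<omega> = (if treat N i \<omega> \<in> {0, 1} \<and> treated_peers N i \<omega> \<in> {0..npeers N i}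
     then Z (treat N i \<omega>) (treated_peers N i \<omega>) \<omega> else 0)"
proof -
  have "realized i Z \<omega> = (\<Sum>x\<in>{0, 1} \<times> {0..npeers N i}.
      if x = (treat N i \<omega>, treated_peers N i \<omega>) then Z (fst x) (snd x) \<omega> else 0)"
    unfolding realized_def by (intro sum.cong) auto
  then show ?thesis by (simp add: sum.delta)
qed

lemma pot_treated_peers_bounds:
  assumes i: "i \<in> focal N" and \<omega>: "\<omega> \<in> space (pspace N)"
  shows "pot_treated_peers N i 0 \<omega> \<le> pot_treated_peers N i 1 \<omega>"
    and "pot_treated_peers N i 1 \<omega> \<le> npeers N i"
proof -
  show "pot_treated_peers N i 0 \<omega> \<le> pot_treated_peers N i 1 \<omega>" by (simp add: pot_treated_peers_def)
  have "(\<Sum>j = 2..npeers N i. link N i j \<omega> * treat N (peer N i j) \<omega>) \<le> (\<Sum>j = 2..npeers N i. 1)"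
  proof (rule sum_mono)
    fix j assume "j \<in> {2..npeers N i}"
    then have j: "j \<in> {1..npeers N i}" by simp
    show "link N i j \<omega> * treat N (peer N i j) \<omega> \<le> 1"
      using link_binary[OF i j \<omega>] treat_binary[of "peer N i j" \<omega>] peer_in_sample[OF i j] \<omega> by auto
  qed
  moreover have "link N i 1 \<omega> \<le> 1" using link_binary[OF i _ \<omega>, of 1] npeers_ge_1[OF i] by auto
  ultimately show "pot_treated_peers N i 1 \<omega> \<le> npeers N i"
    using npeers_ge_1[OF i] by (simp add: pot_treated_peers_def)
qed

text \<open>The centred instrument is 1 - p where D_{1(i)} = 1 and -p where it is 0, and these
  values occur with probabilities p and 1 - p. So the cells with s = 1 and s = 0 carry opposite
  weights of the same size p (1 - p), and the covariance becomes a difference between R_i(1) and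
  R_i(0). The sum over (d, r) leaves the expectation because independence holds for each pair
  separately, and returns once the cells are evaluated.\<close>

lemma realized_cov:
  assumes i: "i \<in> focal N"
    and Z: "\<And>d r. d \<in> {0, 1} \<Longrightarrow> r \<in> {0..npeers N i} \<Longrightarrow> independent_of_treatments i (Z d r)"
    and int: "\<And>d r. d \<in> {0, 1} \<Longrightarrow> r \<in> {0..npeers N i} \<Longrightarrow> integrable (pspace N) (Z d r)"
    and W: "\<And>\<omega>. \<omega> \<in> space (pspace N) \<Longrightarrow> W i \<omega> = realized i Z \<omega>"
  shows "instrument_cov W i = instrument_variance * expectation (\<lambda>\<omega>. \<Sum>d\<in>{0, 1}.
     p_focal N d * (Z d (pot_treated_peers N i 1 \<omega>) \<omega> - Z d (pot_treated_peers N i 0 \<omega>) \<omega>))"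
proof -
  let ?I = "{0, 1 :: nat} \<times> {0..npeers N i}"
  let ?p = "p_peer N 1"
  let ?c = "\<lambda>s d r \<omega>. of_bool (treat N i \<omega> = d \<and> instrument i \<omega> = s \<and> pot_treated_peers N i s \<omega> = r) * Z d r \<omega>"
  let ?m = "\<lambda>s d r \<omega>. of_bool (pot_treated_peers N i s \<omega> = r) * Z d r \<omega>"
  note [measurable] = pot_treated_peers_measurable[OF i]
  have [measurable]: "random_variable (count_space UNIV) (treat N i)"
    "random_variable (count_space UNIV) (instrument i)"
    using i first_peer_in_sample[OF i] by (auto intro: treat_measurable)
  have cint: "integrable (pspace N) (?c s d r)" and mint: "integrable (pspace N) (?m s d r)"
    if "(d, r) \<in> ?I" for s d r
  proof -
    have Zi: "integrable (pspace N) (Z d r)" using that int by auto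
    then show "integrable (pspace N) (?c s d r)" by (rule integrable_of_bool_mult) measurable
    show "integrable (pspace N) (?m s d r)" using Zi by (rule integrable_of_bool_mult) measurable
  qed
  have pointwise: "W i \<omega> * (real (instrument i \<omega>) - ?p)
      = (\<Sum>(d, r)\<in>?I. (1 - ?p) * ?c 1 d r \<omega> - ?p * ?c 0 d r \<omega>)" if \<omega>: "\<omega> \<in> space (pspace N)" for \<omega>
  proof -
    have "instrument i \<omega> \<in> {0, 1}" using treat_binary first_peer_in_sample[OF i] \<omega> by blast
    then show ?thesis
      unfolding W[OF \<omega>] realized_def sum_distrib_right treated_peers_eq[OF i]
      by (intro sum.cong) auto
  qed
  have moment: "expectation (\<lambda>\<omega>. (1 - ?p) * ?c 1 d r \<omega> - ?p * ?c 0 d r \<omega>)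
      = instrument_variance * p_focal N d * (expectation (?m 1 d r) - expectation (?m 0 d r))"
    if dr: "(d, r) \<in> ?I" for d r
  proof -
    have d: "d \<in> {0, 1}" and r: "r \<in> {0..npeers N i}" using dr by auto
    have c: "expectation (?c s d r) = p_focal N d * p_peer N s * expectation (?m s d r)"
      if "s \<in> {0, 1}" for s
      using potential_moment[OF i Z[OF d r] int[OF d r], of d s r]
        prob_treat_focal[OF i d] prob_treat_peer[OF first_peer_in_sample[OF i] that] by simp
    have "expectation (\<lambda>\<omega>. (1 - ?p) * ?c 1 d r \<omega> - ?p * ?c 0 d r \<omega>)
        = (1 - ?p) * expectation (?c 1 d r) - ?p * expectation (?c 0 d r)"
      using cint[OF dr, of 1] cint[OF dr, of 0]
      by (subst Bochner_Integration.integral_diff) auto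
    also have "\<dots> = (1 - ?p) * (p_focal N d * ?p * expectation (?m 1 d r))
        - ?p * (p_focal N d * p_peer N 0 * expectation (?m 0 d r))"
      using c[of 1] c[of 0] by simp
    also have "\<dots> = instrument_variance * p_focal N d * (expectation (?m 1 d r) - expectation (?m 0 d r))"
      unfolding p_peer_0[OF first_peer_in_sample[OF i]] instrument_variance_def
      by (simp add: algebra_simps)
    finally show ?thesis .
  qed
  have "instrument_cov W i = expectation (\<lambda>\<omega>. \<Sum>(d, r)\<in>?I. (1 - ?p) * ?c 1 d r \<omega> - ?p * ?c 0 d r \<omega>)"
    unfolding instrument_cov_def using pointwise by (intro Bochner_Integration.integral_cong) auto
  also have "\<dots> = (\<Sum>(d, r)\<in>?I. expectation (\<lambda>\<omega>. (1 - ?p) * ?c 1 d r \<omega> - ?p * ?c 0 d r \<omega>))"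
    unfolding case_prod_beta using cint by (intro Bochner_Integration.integral_sum) auto
  also have "\<dots> = (\<Sum>(d, r)\<in>?I. instrument_variance * p_focal N d * (expectation (?m 1 d r) - expectation (?m 0 d r)))"
    using moment by (intro sum.cong) auto
  also have "\<dots> = (\<Sum>(d, r)\<in>?I. instrument_variance * expectation (\<lambda>\<omega>. p_focal N d * (?m 1 d r \<omega> - ?m 0 d r \<omega>)))"
    using mint by (intro sum.cong) auto
  also have "\<dots> = instrument_variance * expectation (\<lambda>\<omega>. \<Sum>(d, r)\<in>?I. p_focal N d * (?m 1 d r \<omega> - ?m 0 d r \<omega>))"
    unfolding case_prod_beta sum_distrib_left[symmetric] using mint
    by (subst Bochner_Integration.integral_sum) auto
  also have "expectation (\<lambda>\<omega>. \<Sum>(d, r)\<in>?I. p_focal N d * (?m 1 d r \<omega> - ?m 0 d r \<omega>))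
      = expectation (\<lambda>\<omega>. \<Sum>d\<in>{0, 1}.
          p_focal N d * (Z d (pot_treated_peers N i 1 \<omega>) \<omega> - Z d (pot_treated_peers N i 0 \<omega>) \<omega>))"
  proof (rule Bochner_Integration.integral_cong[OF refl])
    fix \<omega> assume "\<omega> \<in> space (pspace N)"
    from pot_treated_peers_bounds[OF i this]
    \<comment> \<open>The bound R_i(s) \<le> n_i puts the potential count inside the index range;
      otherwise the sum over r would be 0 instead of the value at R_i(s).\<close>
    have mem: "pot_treated_peers N i s \<omega> \<in> {0..npeers N i}" if "s \<in> {0, 1}" for s
      using that by auto
    have m: "(\<Sum>r\<in>{0..npeers N i}. ?m s d r \<omega>) = Z d (pot_treated_peers N i s \<omega>) \<omega>"
      if "s \<in> {0, 1}" for s d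
      using sum.delta'[of "{0..npeers N i}" "pot_treated_peers N i s \<omega>" "\<lambda>r. Z d r \<omega>"] mem[OF that]
      by (simp add: of_bool_def if_distrib[of "\<lambda>x. x * _"] cong: if_cong)
    show "(\<Sum>(d, r)\<in>?I. p_focal N d * (?m 1 d r \<omega> - ?m 0 d r \<omega>))
      = (\<Sum>d\<in>{0, 1}.
          p_focal N d * (Z d (pot_treated_peers N i 1 \<omega>) \<omega> - Z d (pot_treated_peers N i 0 \<omega>) \<omega>))"
      using m by (simp add: sum.cartesian_product[symmetric] sum_distrib_left[symmetric] sum_subtractf)
  qed
  finally show ?thesis .
qed

section \<open>Outcomes and aggregates as realizations\<close>

text \<open>Only the thresholds in \<open>{c<..b}\<close> survive. They are at least 1, so the
  truncated \<open>r - 1\<close> is the true predecessor.\<close>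

lemma sum_telescope_of_bool:
  fixes z :: "nat \<Rightarrow> real"
  assumes "c \<le> b" "b \<le> n"
  shows "(\<Sum>r = 1..n. of_bool (r \<le> b \<and> c < r) * (z r - z (r - 1))) = z b - z c"
proof -
  have "(\<Sum>r = 1..n. of_bool (r \<le> b \<and> c < r) * (z r - z (r - 1))) = (\<Sum>r\<in>{c<..b}. z r - z (r - 1))"
    using assms by (intro sum.mono_neutral_cong_right) auto
  also have "\<dots> = z b - z c"
    using \<open>c \<le> b\<close>
  proof (induction rule: dec_induct)
    case (step m)
    have "{c<..Suc m} = insert (Suc m) {c<..m}" using step by auto
    then show ?case using step by simp
  qed simp
  finally show ?thesis .
qed

lemma outcome_integrable:
  "i \<in> focal N \<Longrightarrow> d \<in> {0, 1} \<Longrightarrow> r \<in> {0..npeers N i} \<Longrightarrow> integrable (pspace N) (outcome N i d r)"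
  using square_integrable_imp_integrable random_outcome second_moment_outcome by blast

lemma complier_event_measurable:
  assumes i: "i \<in> focal N"
  shows "complier_event N i r \<in> events"
proof -
  note [measurable] = pot_treated_peers_measurable[OF i]
  show ?thesis unfolding complier_event_def by measurable
qed

text \<open>At each sample point and for each d, the jump of the outcome from R_i(0) to R_i(1) is a
  sum of unit steps over the thresholds crossed, and the crossing of r is exactly
  \<open>complier_event N i r\<close>.\<close>

lemma outcome_cov:
  assumes i: "i \<in> focal N"
  shows "instrument_cov (observed_outcome N) i = instrument_variance *
    (\<Sum>r = 1..npeers N i. LINT \<omega>:complier_event N i r|pspace N. tau_bar N i r \<omega>)"
proof -
  let ?R = "\<lambda>d \<omega>. pot_treated_peers N i d \<omega>"
  have "instrument_cov (observed_outcome N) i = instrument_variance * expectation (\<lambda>\<omega>. \<Sum>d\<in>{0, 1}.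
     p_focal N d * (outcome N i d (?R 1 \<omega>) \<omega> - outcome N i d (?R 0 \<omega>) \<omega>))"
    using design i
    by (intro realized_cov outcome_integrable)
      (auto simp: independent_of_treatments_def experimental_design_def realized_def observed_outcome_def)
  also have "expectation (\<lambda>\<omega>. \<Sum>d\<in>{0, 1}.
      p_focal N d * (outcome N i d (?R 1 \<omega>) \<omega> - outcome N i d (?R 0 \<omega>) \<omega>))
    = expectation (\<lambda>\<omega>. \<Sum>r = 1..npeers N i. indicator (complier_event N i r) \<omega> *\<^sub>R tau_bar N i r \<omega>)"
  proof (rule Bochner_Integration.integral_cong[OF refl])
    fix \<omega> assume \<omega>: "\<omega> \<in> space (pspace N)"
    note b = pot_treated_peers_bounds[OF i \<omega>]
    have "(\<Sum>d\<in>{0, 1}. p_focal N d * (outcome N i d (?R 1 \<omega>) \<omega> - outcome N i d (?R 0 \<omega>) \<omega>))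
      = (\<Sum>d\<in>{0, 1}. \<Sum>r = 1..npeers N i. p_focal N d *
          (of_bool (r \<le> ?R 1 \<omega> \<and> ?R 0 \<omega> < r) * (outcome N i d r \<omega> - outcome N i d (r - 1) \<omega>)))"
      using sum_telescope_of_bool[OF b, of "\<lambda>r. outcome N i _ r \<omega>"]
      by (simp add: sum_distrib_left[symmetric])
    \<comment> \<open>The crossing event does not depend on d, so with the sum over d innermost the
      weights \<open>p_focal N d\<close> combine the steps into \<open>tau_bar\<close>.\<close>
    also have "\<dots> = (\<Sum>r = 1..npeers N i. \<Sum>d\<in>{0, 1}. p_focal N d *
          (of_bool (r \<le> ?R 1 \<omega> \<and> ?R 0 \<omega> < r) * (outcome N i d r \<omega> - outcome N i d (r - 1) \<omega>)))"
      by (rule sum.swap)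
    also have "\<dots> = (\<Sum>r = 1..npeers N i. indicator (complier_event N i r) \<omega> *\<^sub>R tau_bar N i r \<omega>)"
      using \<omega> by (intro sum.cong) (auto simp: complier_event_def tau_bar_def tau_def algebra_simps)
    finally show "(\<Sum>d\<in>{0, 1}. p_focal N d * (outcome N i d (?R 1 \<omega>) \<omega> - outcome N i d (?R 0 \<omega>) \<omega>))
      = (\<Sum>r = 1..npeers N i. indicator (complier_event N i r) \<omega> *\<^sub>R tau_bar N i r \<omega>)" .
  qed
  also have "\<dots> = (\<Sum>r = 1..npeers N i. expectation (\<lambda>\<omega>. indicator (complier_event N i r) \<omega> *\<^sub>R tau_bar N i r \<omega>))"
  proof (rule Bochner_Integration.integral_sum)
    fix r assume "r \<in> {1..npeers N i}"
    then have r: "r \<in> {0..npeers N i}" "r - 1 \<in> {0..npeers N i}" by auto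
    have "integrable (pspace N) (tau_bar N i r)"
      unfolding tau_bar_def tau_def using outcome_integrable[OF i _ r(1)] outcome_integrable[OF i _ r(2)]
      by (intro Bochner_Integration.integrable_add integrable_mult_left Bochner_Integration.integrable_diff) auto
    then show "integrable (pspace N) (\<lambda>\<omega>. indicator (complier_event N i r) \<omega> *\<^sub>R tau_bar N i r \<omega>)"
      by (intro integrable_mult_indicator complier_event_measurable[OF i])
  qed
  finally show ?thesis by (simp add: set_lebesgue_integral_def)
qed

definition aggregate :: "'a \<Rightarrow> 'b \<Rightarrow> real" where
  "aggregate i \<omega> = aggr N i (treated_peers N i \<omega>)"

lemma treated_peers_le:
  assumes i: "i \<in> focal N" and \<omega>: "\<omega> \<in> space (pspace N)"
  shows "treated_peers N i \<omega> \<le> npeers N i"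
proof -
  have "instrument i \<omega> \<in> {0, 1}" using treat_binary first_peer_in_sample[OF i] \<omega> by blast
  then show ?thesis
    using pot_treated_peers_bounds[OF i \<omega>] unfolding treated_peers_eq[OF i] by auto
qed

text \<open>M_i is realized from potential values that do not depend on d, so the weights
  \<open>p_focal N d\<close> add up to 1 and disappear.\<close>

lemma aggregate_cov:
  assumes i: "i \<in> focal N"
  shows "instrument_cov aggregate i = instrument_variance *
    expectation (\<lambda>\<omega>. pot_aggr N i 1 \<omega> - pot_aggr N i 0 \<omega>)"
proof -
  let ?Z = "\<lambda>(d::nat) r (\<omega>::'b). aggr N i r"
  have "instrument_cov aggregate i = instrument_variance * expectation (\<lambda>\<omega>. \<Sum>d\<in>{0, 1}.
     p_focal N d * (?Z d (pot_treated_peers N i 1 \<omega>) \<omega> - ?Z d (pot_treated_peers N i 0 \<omega>) \<omega>))"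
  proof (rule realized_cov[OF i])
    fix d r :: nat assume d: "d \<in> {0, 1}" and r: "r \<in> {0..npeers N i}"
    have iv: "indep_var (count_space {0, 1 :: real} \<Otimes>\<^sub>M bit_vec_space (npeers N i))
        (\<lambda>\<omega>. (real (treat N i \<omega>), peer_treat_vec N i \<omega>))
        (borel \<Otimes>\<^sub>M bit_vec_space (npeers N i)) (\<lambda>\<omega>. (outcome N i d r \<omega>, link_vec N i \<omega>))"
      using design i d r unfolding experimental_design_def by blast
    show "independent_of_treatments i (?Z d r)"
      unfolding independent_of_treatments_def
      \<comment> \<open>Overwriting the outcome coordinate by a constant keeps the link coordinate,
        so the independence carries over.\<close>
      using indep_var_compose[OF iv measurable_ident,
          of "\<lambda>x. (aggr N i r, snd x)" "borel \<Otimes>\<^sub>M bit_vec_space (npeers N i)"]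
      by (simp add: comp_def)
  next
    fix \<omega> assume \<omega>: "\<omega> \<in> space (pspace N)"
    have t: "treat N i \<omega> \<in> {0, 1}" using treat_binary[of i \<omega>] i \<omega> by simp
    have le: "treated_peers N i \<omega> \<in> {0..npeers N i}" using treated_peers_le[OF i \<omega>] by simp
    show "aggregate i \<omega> = realized i ?Z \<omega>" using t le unfolding realized_eq aggregate_def by auto
  qed simp
  then show ?thesis
    by (simp add: p_focal_0[OF i] pot_aggr_def algebra_simps)
qed

section \<open>The least squares problems\<close>

lemma realized_integrable:
  assumes i: "i \<in> focal N"
    and Z: "\<And>d r. d \<in> {0, 1} \<Longrightarrow> r \<in> {0..npeers N i} \<Longrightarrow> integrable (pspace N) (Z d r)"
  shows "integrable (pspace N) (realized i Z)"
proof -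
  note [measurable] = treated_peers_measurable[OF i]
  have [measurable]: "random_variable (count_space UNIV) (treat N i)"
    using i by (auto intro: treat_measurable)
  show ?thesis
    unfolding realized_def case_prod_beta
    by (intro Bochner_Integration.integrable_sum integrable_of_bool_mult Z) (measurable, auto)
qed

definition square_integrable :: "('b \<Rightarrow> real) \<Rightarrow> bool" where
  "square_integrable f \<longleftrightarrow> f \<in> borel_measurable (pspace N) \<and> integrable (pspace N) (\<lambda>\<omega>. (f \<omega>)\<^sup>2)"

text \<open>Since at most one cell is active, squaring commutes with realization, and no cross terms
  between potential values arise.\<close>

lemma realized_square_integrable:
  assumes i: "i \<in> focal N"
    and Z: "\<And>d r. d \<in> {0, 1} \<Longrightarrow> r \<in> {0..npeers N i} \<Longrightarrow> square_integrable (Z d r)"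
  shows "square_integrable (realized i Z)"
proof -
  have "integrable (pspace N) (realized i Z)"
    using Z by (intro realized_integrable[OF i])
      (auto simp: square_integrable_def intro: square_integrable_imp_integrable)
  moreover have "integrable (pspace N) (realized i (\<lambda>d r \<omega>. (Z d r \<omega>)\<^sup>2))"
    using Z by (intro realized_integrable[OF i]) (auto simp: square_integrable_def)
  moreover have "realized i (\<lambda>d r \<omega>. (Z d r \<omega>)\<^sup>2) = (\<lambda>\<omega>. (realized i Z \<omega>)\<^sup>2)"
    by (auto simp: realized_eq)
  ultimately show ?thesis by (auto simp: square_integrable_def)
qed

lemma observed_outcome_square_integrable:
  assumes "i \<in> focal N"
  shows "square_integrable (observed_outcome N i)"
proof -
  have "square_integrable (realized i (outcome N i))"
    using random_outcome second_moment_outcome assms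
    by (intro realized_square_integrable) (auto simp: square_integrable_def)
  moreover have "realized i (outcome N i) = observed_outcome N i"
    by (simp add: fun_eq_iff realized_def observed_outcome_def)
  ultimately show ?thesis by simp
qed

lemma aggregate_square_integrable:
  assumes i: "i \<in> focal N"
  shows "square_integrable (aggregate i)"
proof -
  have [measurable]: "aggregate i \<in> borel_measurable (pspace N)"
    unfolding aggregate_def by (rule measurable_compose[OF treated_peers_measurable[OF i]]) simp
  have "integrable (pspace N) (\<lambda>\<omega>. (aggregate i \<omega>)\<^sup>2)"
  proof (rule integrable_bounded)
    fix \<omega> assume "\<omega> \<in> space (pspace N)"
    then show "\<bar>(aggregate i \<omega>)\<^sup>2\<bar> \<le> Max ((\<lambda>r. (aggr N i r)\<^sup>2) ` {0..npeers N i})"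
      using treated_peers_le[OF i] by (auto simp: aggregate_def)
  qed measurable
  then show ?thesis by (simp add: square_integrable_def)
qed

lemma centred_instrument_moments:
  assumes i: "i \<in> focal N"
  shows "expectation (\<lambda>\<omega>. real (instrument i \<omega>) - p_peer N 1) = 0"
    and "expectation (\<lambda>\<omega>. real (treat N i \<omega>) * (real (instrument i \<omega>) - p_peer N 1)) = 0"
    and "expectation (\<lambda>\<omega>. real (instrument i \<omega>) * (real (instrument i \<omega>) - p_peer N 1)) = instrument_variance"
    and "expectation (\<lambda>\<omega>. (real (instrument i \<omega>) - p_peer N 1)\<^sup>2) = instrument_variance"
proof -
  let ?p = "p_peer N 1" and ?S = "\<lambda>\<omega>. real (instrument i \<omega>)" and ?D = "\<lambda>\<omega>. real (treat N i \<omega>)"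
  note peer = first_peer_in_sample[OF i]
  have [measurable]: "random_variable (count_space UNIV) (treat N i)"
    "random_variable (count_space UNIV) (instrument i)"
    using i peer by (auto intro: treat_measurable)
  have D: "?D \<omega> \<in> {0, 1}" and S: "?S \<omega> \<in> {0, 1}" if "\<omega> \<in> space (pspace N)" for \<omega>
    using treat_binary[of i \<omega>] treat_binary[of "peer N i 1" \<omega>] i peer that by auto
  have b: "\<bar>?S \<omega>\<bar> \<le> 1" "\<bar>?D \<omega>\<bar> \<le> 1" if "\<omega> \<in> space (pspace N)" for \<omega>
    using D[OF that] S[OF that] by auto
  have int: "integrable (pspace N) ?S" "integrable (pspace N) ?D"
    by (rule integrable_bounded[OF _ b(1)], measurable) (rule integrable_bounded[OF _ b(2)], measurable)
  have intp: "integrable (pspace N) (\<lambda>\<omega>. ?D \<omega> * ?S \<omega>)"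
    by (rule integrable_mult_bounded[OF int(2) _ b(1)]) measurable
  have ES: "expectation ?S = ?p"
    using expectation_treat[of "peer N i 1"] prob_treat_peer[OF peer, of 1] peer by simp
  have ED: "expectation ?D = p_focal N 1"
    using expectation_treat[of i] prob_treat_focal[OF i, of 1] i by simp
  \<comment> \<open>Independence of D_i and the instrument is read off the three-block factorization
    by making the test on the other peers trivial.\<close>
  have "expectation (\<lambda>\<omega>. ?D \<omega> * ?S \<omega>)
      = expectation (\<lambda>\<omega>. of_bool (treat N i \<omega> = 1) * of_bool (instrument i \<omega> = 1) *
          of_bool ((\<lambda>_. True) (other_treated i (\<lambda>_. 0) \<omega>)))"
    by (intro Bochner_Integration.integral_cong) (use D S in \<open>auto simp: of_bool_def\<close>)
  also have "\<dots> = p_focal N 1 * ?p"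
    using treatments_factor[OF i, of 1 1 "\<lambda>_. True" "\<lambda>_. 0"]
      prob_treat_focal[OF i, of 1] prob_treat_peer[OF peer, of 1] by (simp add: prob_space)
  finally have EDS: "expectation (\<lambda>\<omega>. ?D \<omega> * ?S \<omega>) = p_focal N 1 * ?p" .
  show "expectation (\<lambda>\<omega>. ?S \<omega> - ?p) = 0"
    using int ES by (simp add: prob_space)
  show "expectation (\<lambda>\<omega>. ?D \<omega> * (?S \<omega> - ?p)) = 0"
    using int intp EDS ED by (simp add: right_diff_distrib)
  \<comment> \<open>For a binary variable the square equals the variable, so both quadratic moments
    become affine in the instrument.\<close>
  have "expectation (\<lambda>\<omega>. ?S \<omega> * (?S \<omega> - ?p)) = expectation (\<lambda>\<omega>. ?S \<omega> * (1 - ?p))"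
    by (intro Bochner_Integration.integral_cong) (auto dest!: S)
  also have "\<dots> = instrument_variance" using ES by (simp add: instrument_variance_def)
  finally show *: "expectation (\<lambda>\<omega>. ?S \<omega> * (?S \<omega> - ?p)) = instrument_variance" .
  have "expectation (\<lambda>\<omega>. (?S \<omega> - ?p)\<^sup>2) = expectation (\<lambda>\<omega>. ?S \<omega> * (1 - 2 * ?p) + ?p\<^sup>2)"
    by (intro Bochner_Integration.integral_cong) (auto dest!: S simp: power2_eq_square algebra_simps)
  also have "\<dots> = instrument_variance"
    using int ES by (simp add: instrument_variance_def prob_space power2_eq_square algebra_simps)
  finally show "expectation (\<lambda>\<omega>. (?S \<omega> - ?p)\<^sup>2) = instrument_variance" .
qed

text \<open>The shift changes the fitted value by t (D_{1(i)} - p), a direction orthogonal to 1 and D_i; hence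
  the quadratic in t involves the single coefficient cs.\<close>

lemma loss_shift:
  assumes W: "\<And>i. i \<in> focal N \<Longrightarrow> square_integrable (W i)"
  shows "loss W (c0 - t * p_peer N 1) cd (cs + t) = loss W c0 cd cs
    - 2 * t * ((\<Sum>i\<in>focal N. instrument_cov W i) - cs * (real (card (focal N)) * instrument_variance))
    + t\<^sup>2 * (real (card (focal N)) * instrument_variance)"
proof -
  let ?p = "p_peer N 1" and ?S = "\<lambda>i \<omega>. real (instrument i \<omega>)" and ?D = "\<lambda>i \<omega>. real (treat N i \<omega>)"
  let ?X = "\<lambda>i \<omega>. ?S i \<omega> - ?p" and ?B = "\<lambda>i \<omega>. c0 + cd * ?D i \<omega> + cs * ?S i \<omega>"
  let ?e = "\<lambda>i \<omega>. W i \<omega> - c0 - cd * ?D i \<omega> - cs * ?S i \<omega>"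
  \<comment> \<open>The identity holds unit by unit with the same shifted intercept, because the
    centring constant p does not vary with i.\<close>
  have unit: "expectation (\<lambda>\<omega>. (W i \<omega> - (c0 - t * ?p) - cd * ?D i \<omega> - (cs + t) * ?S i \<omega>)\<^sup>2)
      = expectation (\<lambda>\<omega>. (?e i \<omega>)\<^sup>2) - 2 * t * (instrument_cov W i - cs * instrument_variance)
        + t\<^sup>2 * instrument_variance" if i: "i \<in> focal N" for i
  proof -
    note peer = first_peer_in_sample[OF i]
    have [measurable]: "random_variable (count_space UNIV) (treat N i)"
      "random_variable (count_space UNIV) (instrument i)"
      using i peer by (auto intro: treat_measurable)
    have b: "\<bar>?S i \<omega>\<bar> \<le> 1" "\<bar>?D i \<omega>\<bar> \<le> 1" if "\<omega> \<in> space (pspace N)" for \<omega>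
      using treat_binary[of i \<omega>] treat_binary[of "peer N i 1" \<omega>] i peer that by auto
    have Wm [measurable]: "W i \<in> borel_measurable (pspace N)"
      using W[OF i] unfolding square_integrable_def by (rule conjunct1)
    have W2: "integrable (pspace N) (\<lambda>\<omega>. (W i \<omega>)\<^sup>2)"
      using W[OF i] unfolding square_integrable_def by (rule conjunct2)
    have W1: "integrable (pspace N) (W i)" by (rule square_integrable_imp_integrable[OF Wm W2])
    have Bb: "\<bar>?B i \<omega>\<bar> \<le> \<bar>c0\<bar> + \<bar>cd\<bar> + \<bar>cs\<bar>" if "\<omega> \<in> space (pspace N)" for \<omega>
    proof -
      have "\<bar>?B i \<omega>\<bar> \<le> \<bar>c0\<bar> + \<bar>cd\<bar> * \<bar>?D i \<omega>\<bar> + \<bar>cs\<bar> * \<bar>?S i \<omega>\<bar>"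
        unfolding abs_mult[symmetric] by linarith
      also have "\<dots> \<le> \<bar>c0\<bar> + \<bar>cd\<bar> * 1 + \<bar>cs\<bar> * 1"
        using b[OF that] by (intro add_mono mult_left_mono) auto
      finally show ?thesis by simp
    qed
    have Xb: "\<bar>?X i \<omega>\<bar> \<le> 1 + \<bar>?p\<bar>" if "\<omega> \<in> space (pspace N)" for \<omega>
      using b(1)[OF that] by linarith
    have B1: "integrable (pspace N) (?B i)"
      by (rule integrable_bounded[OF _ Bb]) measurable
    have X1: "integrable (pspace N) (?X i)"
      by (rule integrable_bounded[OF _ Xb]) measurable
    have BB: "integrable (pspace N) (\<lambda>\<omega>. ?B i \<omega> * ?B i \<omega>)"
      by (rule integrable_mult_bounded[OF B1 _ Bb]) measurable
    have WB: "integrable (pspace N) (\<lambda>\<omega>. W i \<omega> * ?B i \<omega>)"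
      by (rule integrable_mult_bounded[OF W1 _ Bb]) measurable
    have WX: "integrable (pspace N) (\<lambda>\<omega>. W i \<omega> * ?X i \<omega>)"
      by (rule integrable_mult_bounded[OF W1 _ Xb]) measurable
    have XX: "integrable (pspace N) (\<lambda>\<omega>. ?X i \<omega> * ?X i \<omega>)"
      by (rule integrable_mult_bounded[OF X1 _ Xb]) measurable
    have DX: "integrable (pspace N) (\<lambda>\<omega>. ?D i \<omega> * ?X i \<omega>)"
      by (subst mult.commute, rule integrable_mult_bounded[OF X1 _ b(2)]) measurable
    have SX: "integrable (pspace N) (\<lambda>\<omega>. ?S i \<omega> * ?X i \<omega>)"
      by (subst mult.commute, rule integrable_mult_bounded[OF X1 _ b(1)]) measurable
    have ee: "integrable (pspace N) (\<lambda>\<omega>. (?e i \<omega>)\<^sup>2)"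
    proof -
      have "integrable (pspace N) (\<lambda>\<omega>. (W i \<omega>)\<^sup>2 - 2 * (W i \<omega> * ?B i \<omega>) + ?B i \<omega> * ?B i \<omega>)"
        using W2 WB BB by (intro Bochner_Integration.integrable_add Bochner_Integration.integrable_diff integrable_mult_right)
      then show ?thesis by (rule back_subst) (auto simp: fun_eq_iff power2_eq_square algebra_simps)
    qed
    \<comment> \<open>The new residual is the old one minus t times the centred instrument; in the
      cross term the old residual is split so that each piece is a known moment.\<close>
    have "expectation (\<lambda>\<omega>. (W i \<omega> - (c0 - t * ?p) - cd * ?D i \<omega> - (cs + t) * ?S i \<omega>)\<^sup>2)
      = expectation (\<lambda>\<omega>. (?e i \<omega>)\<^sup>2 - 2 * t * (W i \<omega> * ?X i \<omega> - c0 * ?X i \<omega>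
          - cd * (?D i \<omega> * ?X i \<omega>) - cs * (?S i \<omega> * ?X i \<omega>)) + t\<^sup>2 * (?X i \<omega> * ?X i \<omega>))"
      by (intro Bochner_Integration.integral_cong refl) (simp add: power2_eq_square algebra_simps)
    also have "\<dots> = expectation (\<lambda>\<omega>. (?e i \<omega>)\<^sup>2) - 2 * t * (expectation (\<lambda>\<omega>. W i \<omega> * ?X i \<omega>)
          - c0 * expectation (?X i) - cd * expectation (\<lambda>\<omega>. ?D i \<omega> * ?X i \<omega>)
          - cs * expectation (\<lambda>\<omega>. ?S i \<omega> * ?X i \<omega>)) + t\<^sup>2 * expectation (\<lambda>\<omega>. ?X i \<omega> * ?X i \<omega>)"
      by (simp only: Bochner_Integration.integral_add Bochner_Integration.integral_diff
          Bochner_Integration.integrable_add Bochner_Integration.integrable_diff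
          integrable_mult_right integral_mult_right_zero ee WX X1 DX SX XX)
    finally show ?thesis
      using centred_instrument_moments[OF i]
      by (simp add: instrument_cov_def power2_eq_square)
  qed
  have "loss W (c0 - t * ?p) cd (cs + t) = (\<Sum>i\<in>focal N. expectation (\<lambda>\<omega>. (?e i \<omega>)\<^sup>2)
      - 2 * t * (instrument_cov W i - cs * instrument_variance) + t\<^sup>2 * instrument_variance)"
    unfolding loss_def by (intro sum.cong refl unit)
  then show ?thesis
    by (simp add: loss_def sum.distrib sum_subtractf sum_distrib_left[symmetric] mult.left_commute)
qed

section \<open>Normal equations of the two stages along the centred instrument\<close>

lemma first_stage_eq: "first_stage N (a0, ad, as) = loss aggregate a0 ad as"
  by (simp add: first_stage_def loss_def aggregate_def)

text \<open>Inserting the affine first-stage fit only changes coordinates. The change is singular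
  exactly when \<gamma>s = 0, which uniqueness of the second-stage minimizer will exclude.\<close>

lemma second_stage_eq:
  "second_stage N (\<gamma>0, \<gamma>d, \<gamma>s) (b0, bd, bs) =
    loss (observed_outcome N) (b0 + bs * \<gamma>0) (bd + bs * \<gamma>d) (bs * \<gamma>s)"
  by (simp add: second_stage_def loss_def linear_projection_def algebra_simps)

lemma first_stage_normal_equation:
  assumes "is_arg_min (first_stage N) (\<lambda>_. True) (\<gamma>0, \<gamma>d, \<gamma>s)"
  shows "(\<Sum>i\<in>focal N. instrument_cov aggregate i) = \<gamma>s * (real (card (focal N)) * instrument_variance)"
proof -
  let ?C = "(\<Sum>i\<in>focal N. instrument_cov aggregate i) - \<gamma>s * (real (card (focal N)) * instrument_variance)"
  have "?C = 0"
  proof (rule linear_coefficient_eq_zero)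
    fix t
    have "first_stage N (\<gamma>0, \<gamma>d, \<gamma>s) \<le> first_stage N (\<gamma>0 - t * p_peer N 1, \<gamma>d, \<gamma>s + t)"
      using assms by (simp add: is_arg_min_def linorder_not_less)
    also have "\<dots> = first_stage N (\<gamma>0, \<gamma>d, \<gamma>s) - 2 * t * ?C
        + t\<^sup>2 * (real (card (focal N)) * instrument_variance)"
      unfolding first_stage_eq by (rule loss_shift) (rule aggregate_square_integrable)
    finally show "0 \<le> t\<^sup>2 * (real (card (focal N)) * instrument_variance) - 2 * t * ?C" by simp
  qed
  then show ?thesis by simp
qed

text \<open>The first claim records in one product all that uniqueness yields: a nonempty focal
  sample, a nondegenerate instrument and a nonzero first-stage coefficient. The second is the
  stationarity condition, available once \<gamma>s can be cancelled.\<close>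

lemma second_stage_normal_equation:
  assumes min: "is_unique_arg_min (second_stage N (\<gamma>0, \<gamma>d, \<gamma>s)) (\<beta>0, \<beta>d, \<beta>s)"
  shows "\<gamma>s * (real (card (focal N)) * instrument_variance) \<noteq> 0"
    and "(\<Sum>i\<in>focal N. instrument_cov (observed_outcome N) i)
      = \<beta>s * \<gamma>s * (real (card (focal N)) * instrument_variance)"
proof -
  let ?f = "second_stage N (\<gamma>0, \<gamma>d, \<gamma>s)"
  let ?V = "real (card (focal N)) * instrument_variance"
  let ?C = "(\<Sum>i\<in>focal N. instrument_cov (observed_outcome N) i) - \<beta>s * \<gamma>s * ?V"
  \<comment> \<open>Raising bs by t adds t times the whole first-stage fit; the other two entries
    cancel its intercept and its D_i part, leaving the shift by t * \<gamma>s along the centred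
    instrument.\<close>
  define b where "b t = (\<beta>0 - t * \<gamma>0 - t * \<gamma>s * p_peer N 1, \<beta>d - t * \<gamma>d, \<beta>s + t)" for t
  have le: "?f (\<beta>0, \<beta>d, \<beta>s) \<le> ?f x" for x
    using min unfolding is_unique_arg_min_def is_arg_min_def by (meson linorder_not_less)
  have shift: "?f (b t) = ?f (\<beta>0, \<beta>d, \<beta>s) - 2 * (t * \<gamma>s) * ?C + (t * \<gamma>s)\<^sup>2 * ?V" for t
  proof -
    have "?f (b t) = loss (observed_outcome N) (\<beta>0 + \<beta>s * \<gamma>0 - (t * \<gamma>s) * p_peer N 1)
        (\<beta>d + \<beta>s * \<gamma>d) (\<beta>s * \<gamma>s + t * \<gamma>s)"
      unfolding b_def second_stage_eq
      by (intro arg_cong3[where f = "loss (observed_outcome N)"]) (simp_all add: algebra_simps)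
    also have "\<dots> = ?f (\<beta>0, \<beta>d, \<beta>s) - 2 * (t * \<gamma>s) * ?C + (t * \<gamma>s)\<^sup>2 * ?V"
      unfolding second_stage_eq by (rule loss_shift) (rule observed_outcome_square_integrable)
    finally show ?thesis .
  qed
  have C: "\<gamma>s * ?C = 0"
  proof (rule linear_coefficient_eq_zero)
    fix t
    show "0 \<le> t\<^sup>2 * (\<gamma>s\<^sup>2 * ?V) - 2 * t * (\<gamma>s * ?C)"
      using le[of "b t"] unfolding shift by (simp add: power_mult_distrib mult.assoc)
  qed
  \<comment> \<open>If the product vanished, the linear and the quadratic term would both be 0 along
    \<open>b\<close>, so \<open>b 1\<close> would be a second minimizer with a different last
    coordinate.\<close>
  show V: "\<gamma>s * ?V \<noteq> 0"
  proof
    assume "\<gamma>s * ?V = 0"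
    then have "(1 * \<gamma>s)\<^sup>2 * ?V = 0" by (simp add: power2_eq_square)
    moreover have "2 * (1 * \<gamma>s) * ?C = 2 * (\<gamma>s * ?C)" by (simp only: mult.assoc mult_1)
    ultimately have "?f (b 1) = ?f (\<beta>0, \<beta>d, \<beta>s)" unfolding shift using C by linarith
    then have "is_arg_min ?f (\<lambda>_. True) (b 1)"
      using le by (simp add: is_arg_min_def linorder_not_less)
    then have "b 1 = (\<beta>0, \<beta>d, \<beta>s)" using min unfolding is_unique_arg_min_def by blast
    then show False by (simp add: b_def)
  qed
  then have "\<gamma>s \<noteq> 0" by auto
  with C show "(\<Sum>i\<in>focal N. instrument_cov (observed_outcome N) i) = \<beta>s * \<gamma>s * ?V" by simp
qed

lemma weighted_effect:
  assumes i: "i \<in> focal N"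
  shows "weight N i r * cond_expectation (pspace N) (tau_bar N i r) (complier_event N i r)
    = (LINT \<omega>:complier_event N i r|pspace N. tau_bar N i r \<omega>) * real (card (focal N)) /
      (\<Sum>k\<in>focal N. expectation (\<lambda>\<omega>. pot_aggr N k 1 \<omega> - pot_aggr N k 0 \<omega>))"
proof (cases "prob (complier_event N i r) = 0")
  case True
  then have "AE \<omega> in pspace N. \<omega> \<notin> complier_event N i r"
    using prob_eq_0[OF complier_event_measurable[OF i]] by simp
  then have "(LINT \<omega>:complier_event N i r|pspace N. tau_bar N i r \<omega>) = 0"
    unfolding set_lebesgue_integral_def by (intro integral_eq_zero_AE) (auto elim!: eventually_mono)
  then show ?thesis by (simp add: cond_expectation_def)
qed (simp add: weight_def cond_expectation_def)

end

theorem theorem3p2: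
  fixes N :: "('u, 'w) network"
    and \<gamma>0 \<gamma>d \<gamma>s \<beta>0 \<beta>d \<beta>s :: real
  assumes "network_model N"
    and "experimental_design N"
    and "independent_units N"
    and "is_arg_min (first_stage N) (\<lambda>_. True) (\<gamma>0, \<gamma>d, \<gamma>s)"
    and "is_unique_arg_min (second_stage N (\<gamma>0, \<gamma>d, \<gamma>s)) (\<beta>0, \<beta>d, \<beta>s)"
  shows "\<beta>s = 1 / real (card (focal N)) *
    (\<Sum>i\<in>focal N. \<Sum>r = 1..npeers N i.
       weight N i r * cond_expectation (pspace N) (tau_bar N i r) (complier_event N i r))"
proof -
  interpret designed_network N
    by (intro designed_network.intro designed_network_axioms.intro assms)
  let ?n = "real (card (focal N))"
  let ?G = "\<Sum>k\<in>focal N. expectation (\<lambda>\<omega>. pot_aggr N k 1 \<omega> - pot_aggr N k 0 \<omega>)"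
  let ?E = "\<Sum>i\<in>focal N. \<Sum>r = 1..npeers N i. LINT \<omega>:complier_event N i r|pspace N. tau_bar N i r \<omega>"
  note nonzero = second_stage_normal_equation(1)[OF assms(5)]
  have "(\<Sum>i\<in>focal N. instrument_cov aggregate i) = instrument_variance * ?G"
    unfolding sum_distrib_left by (intro sum.cong refl aggregate_cov)
  then have G: "instrument_variance * ?G = \<gamma>s * (?n * instrument_variance)"
    using first_stage_normal_equation[OF assms(4)] by (simp only:)
  have "(\<Sum>i\<in>focal N. instrument_cov (observed_outcome N) i) = instrument_variance * ?E"
    unfolding sum_distrib_left[of instrument_variance _ "focal N"] by (intro sum.cong refl outcome_cov)
  then have E: "instrument_variance * ?E = \<beta>s * (\<gamma>s * (?n * instrument_variance))"
    using second_stage_normal_equation(2)[OF assms(5)] by (simp only: mult.assoc)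
  from nonzero have pos: "instrument_variance \<noteq> 0" "?n \<noteq> 0" by auto
  \<comment> \<open>The first-stage equation turns the nonvanishing product into a nonzero total
    effect on the aggregates, so the denominator of the weights is legitimate.\<close>
  from nonzero G have "?G \<noteq> 0" by auto
  have "instrument_variance * ?E = instrument_variance * (\<beta>s * ?G)"
    unfolding E G[symmetric] by (simp add: mult.left_commute)
  then have "\<beta>s = ?E / ?G" using pos \<open>?G \<noteq> 0\<close> by (simp only: eq_divide_eq mult_cancel_left) simp
  also have "\<dots> = 1 / ?n * (\<Sum>i\<in>focal N. \<Sum>r = 1..npeers N i.
      (LINT \<omega>:complier_event N i r|pspace N. tau_bar N i r \<omega>) * ?n / ?G)"
    unfolding sum_distrib_right[symmetric] sum_divide_distrib[symmetric] using pos by simp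
  also have "\<dots> = 1 / ?n * (\<Sum>i\<in>focal N. \<Sum>r = 1..npeers N i.
       weight N i r * cond_expectation (pspace N) (tau_bar N i r) (complier_event N i r))"
    by (intro arg_cong2[where f = "(*)"] sum.cong refl weighted_effect[symmetric])
  finally show ?thesis .
qed

end
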